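(* Let $y$ be an integer such that $p=4y^2+3y+1$ is a prime with $p\ge 5$. Let $\beta\in\{-8y-4,\ 8y+2\}$, $\mu=2p-2$, $\lambda=\mu+\beta$ and $k=4p^2-2p+\tfrac{\beta}{2}$. Then no nontrivial regular $(8p^3,k,\lambda,\mu)$-PDS exists in an Abelian group of order $8p^3$.
   Context: Let $G$ be a finite Abelian group of order $v$ with identity $e$, and $D\subseteq G$ a subset of size $k$. $D$ is a $(v,k,\lambda,\mu)$-partial difference set (PDS) in $G$ if the expressions $gh^{-1}$ with $g,h\in D$, $g\neq h$, represent each non-identity element of $D$ exactly $\lambda$ times and each non-identity element of $G$ not in $D$ exactly $\mu$ times. $D$ is regular if moreover $D^{(-1)}=D$ and $e\notin D$. A regular PDS $D$ is trivial if $D\cup\{e\}$ or $G\setminus D$ is a subgroup of $G$. The parameter $\beta$ of a PDS is $\lambda-\mu$. *)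

theory Defs
  imports Complex_Main "HOL-Algebra.Algebra" "HOL-Computational_Algebra.Primes"
begin

definition partial_difference_set ::
  "('a, 'b) monoid_scheme \<Rightarrow> 'a set \<Rightarrow> nat \<Rightarrow> nat \<Rightarrow> nat \<Rightarrow> nat \<Rightarrow> bool" where
  "partial_difference_set G D v k l m \<longleftrightarrow>
     comm_group G \<and> finite (carrier G) \<and> order G = v \<and> D \<subseteq> carrier G \<and> card D = k \<and>
     (\<forall>x \<in> D - {\<one>\<^bsub>G\<^esub>}.
        card {(g, h). g \<in> D \<and> h \<in> D \<and> g \<noteq> h \<and> g \<otimes>\<^bsub>G\<^esub> inv\<^bsub>G\<^esub> h = x} = l) \<and>
     (\<forall>x \<in> carrier G - D - {\<one>\<^bsub>G\<^esub>}.
        card {(g, h). g \<in> D \<and> h \<in> D \<and> g \<noteq> h \<and> g \<otimes>\<^bsub>G\<^esub> inv\<^bsub>G\<^esub> h = x} = m)"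

definition regular_PDS ::
  "('a, 'b) monoid_scheme \<Rightarrow> 'a set \<Rightarrow> nat \<Rightarrow> nat \<Rightarrow> nat \<Rightarrow> nat \<Rightarrow> bool" where
  "regular_PDS G D v k l m \<longleftrightarrow>
     partial_difference_set G D v k l m \<and> (\<lambda>g. inv\<^bsub>G\<^esub> g) ` D = D \<and> \<one>\<^bsub>G\<^esub> \<notin> D"

definition trivial_PDS :: "('a, 'b) monoid_scheme \<Rightarrow> 'a set \<Rightarrow> bool" where
  "trivial_PDS G D \<longleftrightarrow> subgroup (D \<union> {\<one>\<^bsub>G\<^esub>}) G \<or> subgroup (carrier G - D) G"

end

theory Submission
  imports Defs "HOL-Number_Theory.Number_Theory"
begin

text \<open>
  Put \<open>b = \<beta> / 2\<close>; then \<open>b\<^sup>2 + b + 2 = 4 p\<close>, and in the group ring \<open>(D - b)\<^sup>2 = (2 p)\<^sup>2 + \<mu> G\<close>.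
  Comparing \<open>D\<close> raised to a prime power \<open>q\<^sup>n\<close> with the Frobenius image of \<open>D\<close> modulo \<open>q\<close> gives two facts.
  For a prime \<open>q\<close> not dividing \<open>2 p\<close>, the set \<open>D\<close> is closed under \<open>q\<close>-th powers, hence under \<open>s\<close>-th
  powers for every \<open>s\<close> coprime to the group order. For \<open>q\<^sup>n = p\<^sup>3\<close>, writing \<open>G = H S\<close> with
  \<open>|H| = 8\<close> and \<open>|S| = p\<^sup>3\<close>, the numbers \<open>a h = |D \<inter> h S|\<close> satisfy \<open>a h \<equiv> b [h = 1] (mod p)\<close>.

  Counting the pairs of elements of \<open>D\<close> in a common coset of \<open>S\<close> yields
  \<open>(\<Sum>h. (a h - b [h = 1] - p (p - 1) / 2)\<^sup>2) = 4 p\<^sup>2\<close>. All eight terms are squares of multiples of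
  \<open>p\<close>, so \<open>a h = p (p - 1) / 2\<close> for some \<open>h \<noteq> 1\<close>. On the other hand, powers with exponents
  \<open>s \<equiv> 1 (mod 8)\<close> fix \<open>h\<close> and move the other elements of \<open>D \<inter> h S\<close> in orbits of length divisible
  by \<open>p - 1\<close> when \<open>s\<close> is a primitive root modulo \<open>p\<close>, so \<open>a h\<close> is \<open>0\<close> or \<open>1\<close> modulo \<open>p - 1\<close>,
  which is impossible for \<open>p \<ge> 5\<close>.
\<close>

section \<open>Cycles of periodic maps and rotations of lists\<close>

text \<open>Periodicity makes \<open>f\<close> a permutation of \<open>T\<close>, so
  \<open>T\<close> splits into cycles. The length of a cycle is the least period of its points,
  hence a multiple of \<open>n\<close>; the induction removes one cycle at a time.\<close>

lemma dvd_card_if_dvd_periods: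
  assumes "finite T" "\<And>x. x \<in> T \<Longrightarrow> f x \<in> T"
    and "\<And>x. x \<in> T \<Longrightarrow> \<exists>i>0. (f ^^ i) x = x"
    and "\<And>x i. x \<in> T \<Longrightarrow> 0 < i \<Longrightarrow> (f ^^ i) x = x \<Longrightarrow> n dvd i"
  shows "n dvd card T"
  using assms
proof (induction "card T" arbitrary: T rule: less_induct)
  case less
  show ?case
  proof (cases "T = {}")
    case False
    then obtain x where x: "x \<in> T" by blast
    define d where "d = (LEAST i. 0 < i \<and> (f ^^ i) x = x)"
    have d: "0 < d" "(f ^^ d) x = x"
      using LeastI_ex[of "\<lambda>i. 0 < i \<and> (f ^^ i) x = x"] less.prems(3)[OF x] by (auto simp: d_def)
    have d_min: "d \<le> i" if "0 < i" "(f ^^ i) x = x" for i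
      unfolding d_def using that by (intro Least_le) auto
    define orb where "orb = (\<lambda>i. (f ^^ i) x) ` {..<d}"
    have iter_T: "(f ^^ i) z \<in> T" if "z \<in> T" for i z
      using that less.prems(2) by (induction i) auto
    have orb_T: "orb \<subseteq> T" using iter_T[OF x] by (auto simp: orb_def)
    \<comment> \<open>Applying \<open>f\<close> another \<open>d - j\<close> times, \<open>x\<close>
      would return after \<open>d - j + i < d\<close> steps.\<close>
    have neq: False if "i < j" "j < d" "(f ^^ i) x = (f ^^ j) x" for i j
    proof -
      have "(f ^^ (d - j + i)) x = (f ^^ (d - j)) ((f ^^ j) x)"
        using that(3) by (simp add: funpow_add)
      also have "\<dots> = (f ^^ d) x"
        using that by (metis comp_apply funpow_add le_add_diff_inverse2 less_imp_le)
      finally have "d \<le> d - j + i" using d(2) that by (intro d_min) auto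
      then show False using that by linarith
    qed
    have "inj_on (\<lambda>i. (f ^^ i) x) {..<d}"
      unfolding inj_on_def using neq by (metis lessThan_iff nat_neq_iff)
    then have card_orb: "card orb = d" by (simp add: orb_def card_image)
    have f_orb: "f z \<in> orb" if z: "z \<in> orb" for z
    proof -
      obtain i where i: "i < d" "z = (f ^^ i) x" using z by (auto simp: orb_def)
      show ?thesis
      proof (cases "Suc i < d")
        case True
        then show ?thesis using i by (auto simp: orb_def intro!: image_eqI[of _ _ "Suc i"])
      next
        case False
        then have "Suc i = d" using i by simp
        then have "f z = (f ^^ 0) x" using d i by (metis comp_apply funpow.simps(2) funpow_0)
        then show ?thesis using d(1) unfolding orb_def by blast
      qed
    qed
    have iter_orb: "(f ^^ i) z \<in> orb" if "z \<in> orb" for i z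
      using that f_orb by (induction i) auto
    have "n dvd card (T - orb)"
    proof (rule less.hyps)
      show "card (T - orb) < card T"
        using orb_T less.prems(1) card_orb d(1) card_mono[OF less.prems(1) orb_T]
        by (simp add: card_Diff_subset finite_subset)
      \<comment> \<open>If \<open>f z\<close> were in \<open>orb\<close>, iterating further until
        \<open>z\<close> recurs would put \<open>z\<close> itself in \<open>orb\<close>.\<close>
      show "f z \<in> T - orb" if z: "z \<in> T - orb" for z
      proof -
        obtain i where i: "0 < i" "(f ^^ i) z = z" using less.prems(3) z by blast
        have "(f ^^ (i - 1)) (f z) = z"
          using i by (metis Suc_diff_1 comp_apply funpow_Suc_right)
        then show ?thesis using z iter_orb[of "f z" "i - 1"] less.prems(2) by auto
      qed
    qed (use less.prems in auto)
    moreover have "n dvd card orb" using card_orb less.prems(4)[OF x] d by simp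
    moreover have "card T = card (T - orb) + card orb"
      using orb_T less.prems(1) by (metis card_Diff_subset card_mono finite_subset le_add_diff_inverse2)
    ultimately show ?thesis by simp
  qed auto
qed

lemma rotate_eq_mult:
  assumes "rotate i xs = xs"
  shows "rotate (j * i) xs = xs"
  by (induction j) (use assms in \<open>auto simp: rotate_rotate[symmetric] add.commute\<close>)

text \<open>Otherwise \<open>i\<close> is invertible modulo the length \<open>q ^ n\<close>, so some
  multiple of \<open>i\<close> rotates by exactly one place.\<close>

lemma prime_dvd_rotation_period:
  assumes "Factorial_Ring.prime (q :: nat)" "length xs = q ^ n" "rotate i xs = xs" "rotate1 xs \<noteq> xs"
  shows "q dvd i"
proof (rule ccontr)
  assume "\<not> q dvd i"
  then have cop: "coprime i (q ^ n)"
    using assms(1) by (metis coprime_commute coprime_power_right_iff prime_imp_coprime)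
  show False
  proof (cases "length xs \<le> 1")
    case True
    then have "rotate1 xs = xs" by (cases xs) auto
    then show False using assms(4) by simp
  next
    case False
    obtain j where j: "[i * j = 1] (mod length xs)"
      using cop cong_solve_coprime_nat assms(2) by (metis One_nat_def)
    have "rotate (j * i) xs = rotate 1 xs"
      using j by (metis cong_def mult.commute rotate_conv_mod)
    then show False using rotate_eq_mult[OF assms(3), of j] assms(4) by simp
  qed
qed

section \<open>Powers of a subset in the group ring\<close>

context comm_group
begin

definition list_prod :: "'a list \<Rightarrow> 'a" where
  "list_prod xs = foldr (\<otimes>) xs \<one>"

lemma list_prod_simps [simp]:
  "list_prod [] = \<one>" "list_prod (x # xs) = x \<otimes> list_prod xs"
  by (simp_all add: list_prod_def)

lemma list_prod_closed [simp, intro]: "set xs \<subseteq> carrier G \<Longrightarrow> list_prod xs \<in> carrier G"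
  by (induction xs) auto

lemma list_prod_append:
  "set xs \<subseteq> carrier G \<Longrightarrow> set ys \<subseteq> carrier G \<Longrightarrow> list_prod (xs @ ys) = list_prod xs \<otimes> list_prod ys"
  by (induction xs) (auto simp: m_assoc)

lemma list_prod_rotate1: "set xs \<subseteq> carrier G \<Longrightarrow> list_prod (rotate1 xs) = list_prod xs"
  by (cases xs) (auto simp: list_prod_append m_comm)

lemma list_prod_replicate: "x \<in> carrier G \<Longrightarrow> list_prod (replicate n x) = x [^] n"
  by (induction n) (auto simp: m_comm)

text \<open>The number of these lists is the coefficient of \<open>g\<close> in the
  \<open>n\<close>-th power of \<open>D\<close> in the integral group ring.\<close>

definition factorisations :: "'a set \<Rightarrow> nat \<Rightarrow> 'a \<Rightarrow> 'a list set" where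
  "factorisations D n g = {xs. set xs \<subseteq> D \<and> length xs = n \<and> list_prod xs = g}"

lemma finite_factorisations: "finite D \<Longrightarrow> finite (factorisations D n g)"
  unfolding factorisations_def by (rule finite_subset[OF _ finite_lists_length_eq[of D n]]) auto

text \<open>The Frobenius map of the group ring modulo \<open>q\<close>. By commutativity, rotation
  acts on the factorisations of \<open>g\<close>; the lists it moves form cycles of length divisible
  by \<open>q\<close>.\<close>

lemma card_factorisations_prime_power:
  assumes q: "Factorial_Ring.prime (q :: nat)" and D: "finite D" "D \<subseteq> carrier G"
  shows "[card (factorisations D (q ^ n) g) = card {d \<in> D. d [^] (q ^ n) = g}] (mod q)"
proof -
  let ?F = "factorisations D (q ^ n) g"
  define T where "T = {xs \<in> ?F. rotate1 xs \<noteq> xs}"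
  have fin: "finite ?F" using D by (simp add: finite_factorisations)
  have pos: "q ^ n > 0" using q by (simp add: prime_gt_0_nat)
  have "q dvd card T"
  proof (rule dvd_card_if_dvd_periods[where f = rotate1])
    show "finite T" using fin by (simp add: T_def)
    show "rotate1 xs \<in> T" if "xs \<in> T" for xs
      using that D by (auto simp: T_def factorisations_def list_prod_rotate1
          dest: injD[OF inj_rotate1])
    show "\<exists>i>0. (rotate1 ^^ i) xs = xs" if "xs \<in> T" for xs
    proof -
      have "rotate (q ^ n) xs = xs"
        using that by (intro rotate_id) (auto simp: T_def factorisations_def)
      then show ?thesis using pos unfolding rotate_def by blast
    qed
    show "q dvd i" if "xs \<in> T" "0 < i" "(rotate1 ^^ i) xs = xs" for xs i
      using that prime_dvd_rotation_period[OF q, of xs n i]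
      by (auto simp: T_def factorisations_def rotate_def)
  qed
  \<comment> \<open>A list invariant under rotation is constant.\<close>
  have bij: "{xs \<in> ?F. rotate1 xs = xs} = replicate (q ^ n) ` {d \<in> D. d [^] (q ^ n) = g}"
    (is "?L = ?R")
  proof
    show "?R \<subseteq> ?L"
      using D pos by (auto simp: factorisations_def list_prod_replicate rotate1_replicate)
    show "?L \<subseteq> ?R"
    proof
      fix xs assume xs: "xs \<in> ?L"
      then have rot: "rotate i xs = xs" for i
        by (induction i) auto
      define x where "x = hd xs"
      have len: "length xs = q ^ n" using xs by (simp add: factorisations_def)
      have ne: "xs \<noteq> []" using pos len by auto
      have nth: "xs ! i = x" if "i < length xs" for i
        using rot[of i] hd_rotate_conv_nth[OF ne, of i] that by (simp add: x_def)
      have eq: "xs = replicate (q ^ n) x"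
        using nth len by (intro nth_equalityI) auto
      have "x \<in> D" using ne xs by (auto simp: x_def factorisations_def)
      moreover have "x [^] (q ^ n) = g"
        using xs eq \<open>x \<in> D\<close> D list_prod_replicate[of x "q ^ n"] by (auto simp: factorisations_def)
      ultimately show "xs \<in> ?R" using eq by blast
    qed
  qed
  have "inj_on (replicate (q ^ n)) {d \<in> D. d [^] (q ^ n) = g}"
    using pos by (auto simp: inj_on_def replicate_eq_replicate)
  then have "card {xs \<in> ?F. rotate1 xs = xs} = card {d \<in> D. d [^] (q ^ n) = g}"
    using bij by (simp add: card_image)
  moreover have "card ?F = card T + card {xs \<in> ?F. rotate1 xs = xs}"
  proof -
    have "?F = T \<union> {xs \<in> ?F. rotate1 xs = xs}" by (auto simp: T_def)
    moreover have "T \<inter> {xs \<in> ?F. rotate1 xs = xs} = {}" by (auto simp: T_def)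
    ultimately show ?thesis using fin by (metis card_Un_disjoint finite_Un)
  qed
  ultimately show ?thesis using \<open>q dvd card T\<close>
    by (simp add: cong_def mod_add_left_eq[symmetric, of "card T"])
qed

text \<open>Coefficient form of \<open>D^(n+1) = D D^n\<close>, splitting off the first factor
  \<open>d\<close>.\<close>

lemma card_factorisations_Suc:
  assumes D: "finite D" "D \<subseteq> carrier G" and g: "g \<in> carrier G"
  shows "card (factorisations D (Suc n) g) = (\<Sum>d\<in>D. card (factorisations D n (g \<otimes> inv d)))"
proof -
  have "factorisations D (Suc n) g = (\<Union>d\<in>D. (#) d ` factorisations D n (g \<otimes> inv d))"
    (is "?L = ?R")
  proof
    show "?L \<subseteq> ?R"
    proof
      fix xs assume xs: "xs \<in> ?L"
      then obtain d ys where ys: "xs = d # ys" "length ys = n" "d \<in> D" "set ys \<subseteq> D"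
        by (auto simp: factorisations_def length_Suc_conv)
      have "g = d \<otimes> list_prod ys" using xs ys by (auto simp: factorisations_def)
      then have "list_prod ys = g \<otimes> inv d"
        using ys D g by (metis inv_solve_right list_prod_closed m_comm subset_iff order_trans)
      then show "xs \<in> ?R" using ys by (auto simp: factorisations_def)
    qed
    show "?R \<subseteq> ?L"
      using D g by (auto simp: factorisations_def m_comm[of g] inv_solve_left' subset_iff
          m_assoc[symmetric])
  qed
  moreover have "card (\<Union>d\<in>D. (#) d ` factorisations D n (g \<otimes> inv d))
      = (\<Sum>d\<in>D. card ((#) d ` factorisations D n (g \<otimes> inv d)))"
    using D by (intro card_UN_disjoint) (auto simp: finite_factorisations)
  ultimately show ?thesis by (simp add: card_image)
qed

end


section \<open>Powers of a partial difference set modulo a prime\<close>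

lemma fermat_int:
  assumes q: "Factorial_Ring.prime (q :: nat)"
  shows "[x ^ (q ^ n) = x] (mod int q)"
proof (induction n)
  case (Suc n)
  have *: "[z ^ q = z] (mod int q)" for z :: int
  proof (cases "int q dvd z")
    case True
    then have "int q dvd z ^ q" using q by (simp add: dvd_power_iff prime_gt_0_nat dvd_trans[OF True dvd_power])
    then show ?thesis using True by (simp add: cong_iff_dvd_diff)
  next
    case False
    define k where "k = nat (z mod int q)"
    have qpos: "q > 0" using q by (simp add: prime_gt_0_nat)
    have k: "int k = z mod int q" using qpos by (simp add: k_def)
    have "\<not> q dvd k" using False k by (metis dvd_mod_iff dvd_refl int_dvd_int_iff)
    then have "[k ^ (q - 1) = 1] (mod q)" using q by (intro fermat_theorem)
    then have "[k ^ (q - 1) * k = 1 * k] (mod q)" by (rule cong_mult) simp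
    then have "[k ^ q = k] (mod q)" using qpos by (metis mult.left_neutral power_minus_mult)
    then have "[int k ^ q = int k] (mod int q)" by (metis cong_int_iff of_nat_power)
    moreover have "[int k = z] (mod int q)" using k by (simp add: cong_def)
    ultimately show ?thesis by (metis cong_pow cong_sym cong_trans)
  qed
  have "[(x ^ (q ^ n)) ^ q = x ^ (q ^ n)] (mod int q)" by (rule *)
  then have "[x ^ (q ^ Suc n) = x ^ (q ^ n)] (mod int q)"
    by (metis power_Suc2 power_mult)
  then show ?case using Suc.IH by (rule cong_trans)
qed simp

text \<open>The assumption \<open>card_differences\<close> is the equation
  \<open>(D - b)^2 = c^2 + m G\<close> in the group ring, read off at \<open>g\<close>. Hence
  nonprincipal characters take only the values \<open>b + c\<close> and \<open>b - c\<close> on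
  \<open>D\<close>.\<close>

locale regular_pds = comm_group G for G (structure) +
  fixes D :: "'a set" and m b c :: int
  assumes finite_carrier: "finite (carrier G)"
    and D_subset: "D \<subseteq> carrier G"
    and inv_D: "d \<in> D \<Longrightarrow> inv d \<in> D"
    and one_notin_D: "\<one> \<notin> D"
    and card_differences: "g \<in> carrier G \<Longrightarrow> int (card {d \<in> D. g \<otimes> inv d \<in> D})
      = (c\<^sup>2 - b\<^sup>2) * of_bool (g = \<one>) + 2 * b * of_bool (g \<in> D) + m"
begin

lemma finite_D: "finite D"
  using D_subset finite_carrier finite_subset by blast

lemma card_D: "int (card D) = c\<^sup>2 - b\<^sup>2 + m"
proof -
  have "{d \<in> D. \<one> \<otimes> inv d \<in> D} = D" using inv_D D_subset by auto
  then show ?thesis using card_differences[of \<one>] one_notin_D by simp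
qed

text \<open>
  The first two equations say that \<open>t\<^sup>n\<close> has remainder \<open>A t + B\<close> modulo the minimal polynomial
  \<open>(t - b)\<^sup>2 - c\<^sup>2\<close> of the nonprincipal character values of \<open>D\<close>.
\<close>

lemma card_factorisations_coeffs:
  "\<exists>A B C. A * (b + c) + B = (b + c) ^ n \<and> A * (b - c) + B = (b - c) ^ n \<and>
     [A = int n * b ^ (n - 1)] (mod c) \<and> [B = (1 - int n) * b ^ n] (mod c) \<and>
     (\<forall>g \<in> carrier G. int (card (factorisations D n g)) = A * of_bool (g \<in> D) + B * of_bool (g = \<one>) + C)"
proof (induction n)
  case 0
  have "factorisations D 0 g = (if g = \<one> then {[]} else {})" for g
    by (auto simp: factorisations_def)
  then have "\<forall>g \<in> carrier G. int (card (factorisations D 0 g)) = 0 * of_bool (g \<in> D) + 1 * of_bool (g = \<one>) + 0"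
    by simp
  then show ?case by (intro exI[of _ "0::int"] exI[of _ "1::int"] conjI) simp_all
next
  case (Suc n)
  then obtain A B C where 1: "A * (b + c) + B = (b + c) ^ n" and 2: "A * (b - c) + B = (b - c) ^ n"
    and A: "[A = int n * b ^ (n - 1)] (mod c)" and B: "[B = (1 - int n) * b ^ n] (mod c)"
    and N: "\<And>g. g \<in> carrier G \<Longrightarrow>
      int (card (factorisations D n g)) = A * of_bool (g \<in> D) + B * of_bool (g = \<one>) + C"
    by blast
  \<comment> \<open>Multiply \<open>A D + B + C G\<close> by \<open>D\<close>, using
    \<open>D^2 = 2 b D + (c^2 - b^2) + m G\<close> and \<open>D G = |D| G\<close>.\<close>
  let ?A = "2 * b * A + B" and ?B = "(c\<^sup>2 - b\<^sup>2) * A" and ?C = "m * A + int (card D) * C"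
  have "int (card (factorisations D (Suc n) g)) = ?A * of_bool (g \<in> D) + ?B * of_bool (g = \<one>) + ?C"
    if g: "g \<in> carrier G" for g
  proof -
    have "int (card (factorisations D (Suc n) g))
        = (\<Sum>d\<in>D. int (card (factorisations D n (g \<otimes> inv d))))"
      by (simp add: card_factorisations_Suc[OF finite_D D_subset g])
    also have "\<dots> = (\<Sum>d\<in>D. A * of_bool (g \<otimes> inv d \<in> D) + B * of_bool (d = g) + C)"
    proof (rule sum.cong)
      fix d assume "d \<in> D"
      then have d: "d \<in> carrier G" using D_subset by blast
      have "g \<otimes> inv d = \<one> \<longleftrightarrow> d = g"
        using d g by (metis inv_closed inv_equality inv_inv r_inv)
      then show "int (card (factorisations D n (g \<otimes> inv d)))
          = A * of_bool (g \<otimes> inv d \<in> D) + B * of_bool (d = g) + C"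
        using N[of "g \<otimes> inv d"] d g by simp
    qed simp
    also have "\<dots> = A * (\<Sum>d\<in>D. of_bool (g \<otimes> inv d \<in> D)) + B * (\<Sum>d\<in>D. of_bool (d = g)) + int (card D) * C"
      by (simp only: sum.distrib sum_distrib_left[symmetric]) simp
    also have "(\<Sum>d\<in>D. of_bool (g \<otimes> inv d \<in> D)) = int (card {d \<in> D. g \<otimes> inv d \<in> D})"
      using finite_D by (simp add: Int_def)
    also have "(\<Sum>d\<in>D. of_bool (d = g)) = (of_bool (g \<in> D) :: int)"
      using finite_D by (simp add: of_bool_def)
    finally show ?thesis using card_differences[OF g] by (simp add: algebra_simps)
  qed
  moreover have "?A * (b + c) + ?B = (b + c) ^ Suc n"
  proof -
    have "?A * (b + c) + ?B = (b + c) * (A * (b + c) + B)"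
      by (simp add: algebra_simps power2_eq_square)
    then show ?thesis using 1 by simp
  qed
  moreover have "?A * (b - c) + ?B = (b - c) ^ Suc n"
  proof -
    have "?A * (b - c) + ?B = (b - c) * (A * (b - c) + B)"
      by (simp add: algebra_simps power2_eq_square)
    then show ?thesis using 2 by simp
  qed
  \<comment> \<open>Modulo \<open>c\<close> the minimal polynomial is \<open>(t - b)^2\<close>, so
    the remainder of \<open>t^n\<close> is its linear Taylor polynomial
    \<open>b^n + n b^(n-1) (t - b)\<close>. The case \<open>n = 0\<close> is split off because
    \<open>n - 1\<close> truncates.\<close>
  moreover have "[?A = int (Suc n) * b ^ (Suc n - 1)] (mod c)"
  proof -
    have "[?A = 2 * b * (int n * b ^ (n - 1)) + (1 - int n) * b ^ n] (mod c)"
      using A B by (intro cong_add cong_mult) auto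
    also have "2 * b * (int n * b ^ (n - 1)) + (1 - int n) * b ^ n = int (Suc n) * b ^ (Suc n - 1)"
      by (cases n) (simp_all add: algebra_simps)
    finally show ?thesis .
  qed
  moreover have "[?B = (1 - int (Suc n)) * b ^ Suc n] (mod c)"
  proof -
    have "[?B = (0 - b\<^sup>2) * (int n * b ^ (n - 1))] (mod c)"
      using A by (intro cong_mult cong_diff) (auto simp: cong_0_iff)
    also have "(0 - b\<^sup>2) * (int n * b ^ (n - 1)) = (1 - int (Suc n)) * b ^ Suc n"
      by (cases n) (simp_all add: algebra_simps power2_eq_square)
    finally show ?thesis .
  qed
  ultimately show ?case by blast
qed

text \<open>By Fermat, \<open>t^q\<close> and \<open>t\<close> agree modulo \<open>q\<close> at
  \<open>b + c\<close> and \<open>b - c\<close>. As \<open>2 c\<close> is invertible, this gives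
  \<open>A = 1\<close> and \<open>B = 0\<close> modulo \<open>q\<close>, so the Frobenius image of
  \<open>D\<close> is \<open>D + C G\<close> modulo \<open>q\<close>.\<close>

lemma pow_prime_mem:
  assumes q: "Factorial_Ring.prime q" "\<not> q dvd order G" "\<not> int q dvd 2 * c" and x: "x \<in> D"
  shows "x [^] q \<in> D"
proof -
  obtain A B C where 1: "A * (b + c) + B = (b + c) ^ q" and 2: "A * (b - c) + B = (b - c) ^ q"
    and N: "\<And>g. g \<in> carrier G \<Longrightarrow>
      int (card (factorisations D q g)) = A * of_bool (g \<in> D) + B * of_bool (g = \<one>) + C"
    using card_factorisations_coeffs[of q] by blast
  have fermat: "[z ^ q = z] (mod int q)" for z using fermat_int[OF q(1), of z 1] by simp
  \<comment> \<open>Subtracting the two values eliminates \<open>B\<close>.\<close>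
  have "[(b + c) ^ q - (b - c) ^ q = (b + c) - (b - c)] (mod int q)"
    by (intro cong_diff fermat)
  then have "[A * (2 * c) = 1 * (2 * c)] (mod int q)"
    by (simp add: 1[symmetric] 2[symmetric] algebra_simps)
  moreover have "coprime (2 * c) (int q)"
    using q by (metis coprime_commute prime_imp_coprime prime_int_nat_transfer
        prime_nat_int_transfer)
  ultimately have A: "[A = 1] (mod int q)" using cong_mult_rcancel by blast
  have "[B = (b + c) ^ q - A * (b + c)] (mod int q)" by (simp add: 1[symmetric])
  also have "[(b + c) ^ q - A * (b + c) = (b + c) - 1 * (b + c)] (mod int q)"
    by (intro cong_diff cong_mult A fermat) simp
  finally have B: "[B = 0] (mod int q)" by simp
  have F: "[int (card {d \<in> D. d [^] q = g}) = of_bool (g \<in> D) + C] (mod int q)"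
    if g: "g \<in> carrier G" for g
  proof -
    have "[int (card {d \<in> D. d [^] q = g}) = int (card (factorisations D q g))] (mod int q)"
      using card_factorisations_prime_power[OF q(1) finite_D D_subset, of 1 g]
      by (simp add: cong_int_iff cong_sym)
    also have "[int (card (factorisations D q g)) = 1 * of_bool (g \<in> D) + 0 * of_bool (g = \<one>) + C] (mod int q)"
      unfolding N[OF g] by (intro cong_add cong_mult A B) auto
    finally show ?thesis by simp
  qed
  have no_root: "d = \<one>" if d: "d \<in> carrier G" "d [^] q = \<one>" for d
  proof -
    have "ord d dvd q" using d pow_eq_id by blast
    moreover have "ord d dvd order G" using ord_dvd_group_order[OF d(1)] .
    ultimately have "ord d = 1" using q by (metis prime_nat_iff)
    then show ?thesis using d(1) ord_eq_1 by blast
  qed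
  \<comment> \<open>Comparing coefficients at \<open>\<one>\<close>, which is neither in
    \<open>D\<close> nor a \<open>q\<close>-th power of an element of \<open>D\<close>, forces
    \<open>C\<close> to vanish modulo \<open>q\<close>.\<close>
  have none: "{d \<in> D. d [^] q = \<one>} = {}" using no_root D_subset one_notin_D by blast
  have C: "[C = 0] (mod int q)" using F[of \<one>] none one_notin_D by (simp add: cong_sym)
  have "D \<subseteq> (\<lambda>d. d [^] q) ` D"
  proof
    fix g assume g: "g \<in> D"
    have "[int (card {d \<in> D. d [^] q = g}) = 1 + C] (mod int q)" using F[of g] g D_subset by auto
    also have "[1 + C = 1 + 0] (mod int q)" by (intro cong_add C) simp
    finally have "[int (card {d \<in> D. d [^] q = g}) = 1] (mod int q)" by simp
    moreover have "\<not> [0 = 1] (mod int q)" using q(1) prime_gt_1_nat[OF q(1)]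
      by (simp add: cong_def)
    ultimately have "{d \<in> D. d [^] q = g} \<noteq> {}" by (metis card.empty of_nat_0)
    then show "g \<in> (\<lambda>d. d [^] q) ` D" by blast
  qed
  \<comment> \<open>The image has at most as many elements as \<open>D\<close>, so the inclusion is
    an equality.\<close>
  then have "D = (\<lambda>d. d [^] q) ` D"
    using finite_D by (intro card_seteq card_image_le finite_imageI)
  then show ?thesis using x by blast
qed

text \<open>Peel off the prime factors of \<open>s\<close> one by one; none divides the group order,
  hence none divides \<open>2 * c\<close>.\<close>

lemma pow_coprime_mem:
  assumes "coprime s (order G)" and "\<And>q. Factorial_Ring.prime q \<Longrightarrow> int q dvd 2 * c \<Longrightarrow> q dvd order G"
    and "x \<in> D"
  shows "x [^] s \<in> D"
  using assms(1,3)
proof (induction s arbitrary: x rule: less_induct)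
  case (less s)
  have x: "x \<in> carrier G" "x \<noteq> \<one>" using less.prems D_subset one_notin_D by auto
  show ?case
  proof (cases "s = 1")
    case False
    then obtain q where q: "Factorial_Ring.prime q" "q dvd s" using prime_factor_nat by blast
    then obtain t where t: "s = q * t" by blast
    \<comment> \<open>Zero is coprime to the order only in the trivial group, which has no room for
      \<open>x \<noteq> \<one>\<close>.\<close>
    have "s \<noteq> 0"
    proof
      assume "s = 0"
      then have "x [^] (1::nat) = \<one>" using pow_order_eq_1[OF x(1)] less.prems by simp
      then show False using x by simp
    qed
    have cop: "\<not> q dvd order G" using less.prems(1) q
      by (metis coprime_common_divisor not_prime_unit)
    have "t < s" using t q \<open>s \<noteq> 0\<close> prime_gt_1_nat[OF q(1)] by simp
    moreover have "coprime t (order G)" using less.prems(1) t by simp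
    moreover have "x [^] q \<in> D"
      using pow_prime_mem[OF q(1) cop] assms(2)[OF q(1)] cop less.prems by blast
    ultimately have "(x [^] q) [^] t \<in> D" using less.IH by blast
    then show ?thesis using x t by (simp add: nat_pow_pow)
  qed (use less.prems x in simp)
qed

text \<open>Since \<open>p\<close> divides \<open>c\<close>, the remainder coefficients reduce to
  \<open>A = 0\<close> and \<open>B = b\<close> modulo \<open>p\<close>. The coefficient at
  \<open>z\<close>, which has no \<open>p ^ n\<close>-th root, shows that \<open>C\<close> vanishes
  as well.\<close>

lemma card_prime_power_roots:
  assumes p: "Factorial_Ring.prime p" "int p dvd c" and "n > 0"
    and z: "z \<in> carrier G" "\<And>x. x \<in> carrier G \<Longrightarrow> x [^] (p ^ n) \<noteq> z" and g: "g \<in> carrier G"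
  shows "[int (card {d \<in> D. d [^] (p ^ n) = g}) = b * of_bool (g = \<one>)] (mod int p)"
proof -
  obtain A B C where A: "[A = int (p ^ n) * b ^ (p ^ n - 1)] (mod c)"
    and B: "[B = (1 - int (p ^ n)) * b ^ (p ^ n)] (mod c)"
    and N: "\<And>g. g \<in> carrier G \<Longrightarrow>
      int (card (factorisations D (p ^ n) g)) = A * of_bool (g \<in> D) + B * of_bool (g = \<one>) + C"
    using card_factorisations_coeffs[of "p ^ n"] by blast
  have pn: "[int (p ^ n) = 0] (mod int p)" using \<open>n > 0\<close> by (simp add: cong_0_iff)
  have "[A = int (p ^ n) * b ^ (p ^ n - 1)] (mod int p)" using A p(2) by (rule cong_dvd_modulus)
  also have "[int (p ^ n) * b ^ (p ^ n - 1) = 0 * b ^ (p ^ n - 1)] (mod int p)"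
    by (intro cong_mult pn) simp
  finally have A: "[A = 0] (mod int p)" by simp
  have "[B = (1 - int (p ^ n)) * b ^ (p ^ n)] (mod int p)" using B p(2) by (rule cong_dvd_modulus)
  also have "[(1 - int (p ^ n)) * b ^ (p ^ n) = (1 - 0) * b] (mod int p)"
    by (intro cong_mult cong_diff pn fermat_int p) simp
  finally have B: "[B = b] (mod int p)" by simp
  have F: "[int (card {d \<in> D. d [^] (p ^ n) = g}) = b * of_bool (g = \<one>) + C] (mod int p)"
    if g: "g \<in> carrier G" for g
  proof -
    have "[int (card {d \<in> D. d [^] (p ^ n) = g}) = int (card (factorisations D (p ^ n) g))] (mod int p)"
      using card_factorisations_prime_power[OF p(1) finite_D D_subset, of n g]
      by (simp only: cong_int_iff cong_sym)
    also have "[int (card (factorisations D (p ^ n) g)) = 0 * of_bool (g \<in> D) + b * of_bool (g = \<one>) + C] (mod int p)"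
      unfolding N[OF g] by (intro cong_add cong_mult A B) auto
    finally show ?thesis by simp
  qed
  have none: "{d \<in> D. d [^] (p ^ n) = z} = {}" using z D_subset by blast
  have "z \<noteq> \<one>" using z(2)[of \<one>] by auto
  then have "[C = 0] (mod int p)" using F[OF z(1)] unfolding none by (simp add: cong_sym)
  then have "[b * of_bool (g = \<one>) + C = b * of_bool (g = \<one>) + 0] (mod int p)"
    by (intro cong_add) auto
  then show ?thesis using F[OF g] cong_trans by fastforce
qed


end

section \<open>Abelian groups as products of subgroups of coprime orders\<close>

lemma (in group) pow_card_subgroup:
  assumes "subgroup H G" "x \<in> H"
  shows "x [^] card H = \<one>"
proof -
  interpret H: group "G\<lparr>carrier := H\<rparr>" using assms(1) by (rule subgroup_imp_group)
  have "x [^]\<^bsub>G\<lparr>carrier := H\<rparr>\<^esub> order (G\<lparr>carrier := H\<rparr>) = \<one>\<^bsub>G\<lparr>carrier := H\<rparr>\<^esub>"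
    using assms(2) by (intro H.pow_order_eq_1) simp
  then show ?thesis by (simp add: order_def nat_pow_consistent[symmetric])
qed

lemma (in group) eq_one_if_coprime_pows:
  fixes i j :: nat
  assumes "x \<in> carrier G" "x [^] i = \<one>" "x [^] j = \<one>" "coprime i j"
  shows "x = \<one>"
proof -
  have "ord x dvd i" "ord x dvd j" using assms pow_eq_id by blast+
  then have "ord x = 1" using assms(4) by (meson coprime_common_divisor_nat nat_dvd_1_iff_1 coprime_common_divisor)
  then show ?thesis using assms(1) ord_eq_1 by blast
qed

lemma (in group) pow_eq_pow_iff_cong:
  fixes i j :: nat
  assumes "x \<in> carrier G"
  shows "x [^] i = x [^] j \<longleftrightarrow> [i = j] (mod ord x)"
proof -
  have "x [^] i = x [^] j \<longleftrightarrow> x [^] int i = x [^] int j" by (simp add: int_pow_int)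
  also have "\<dots> \<longleftrightarrow> int (ord x) dvd int j - int i" using assms by (rule int_pow_eq)
  also have "\<dots> \<longleftrightarrow> [i = j] (mod ord x)"
    by (metis cong_iff_dvd_diff cong_int_iff cong_sym)
  finally show ?thesis .
qed

locale hall_decomposition = comm_group G for G (structure) +
  fixes H S :: "'a set"
  assumes finite_carrier: "finite (carrier G)"
    and H: "subgroup H G" and S: "subgroup S G"
    and coprime_cards: "coprime (card H) (card S)"
    and order_eq: "order G = card H * card S"
begin

lemma H_carrier: "h \<in> H \<Longrightarrow> h \<in> carrier G" and S_carrier: "u \<in> S \<Longrightarrow> u \<in> carrier G"
  using subgroup.mem_carrier[OF H] subgroup.mem_carrier[OF S] by auto

lemma finite_H: "finite H" and finite_S: "finite S"
  using subgroup.subset[OF H] subgroup.subset[OF S] finite_carrier finite_subset by blast+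

text \<open>Two representations of one element differ by some \<open>w\<close> in both
  \<open>H\<close> and \<open>S\<close>, which is \<open>\<one>\<close> by coprimality; surjectivity
  follows by counting.\<close>

lemma bij_betw_mult: "bij_betw (\<lambda>(h, u). h \<otimes> u) (H \<times> S) (carrier G)"
proof -
  have inj: "inj_on (\<lambda>(h, u). h \<otimes> u) (H \<times> S)"
  proof (rule inj_onI, clarify)
    fix h u h' u' assume *: "h \<in> H" "u \<in> S" "h' \<in> H" "u' \<in> S" "h \<otimes> u = h' \<otimes> u'"
    have car: "h \<in> carrier G" "u \<in> carrier G" "h' \<in> carrier G" "u' \<in> carrier G"
      using * H_carrier S_carrier by auto
    define w where "w = inv h' \<otimes> h"
    have "w \<otimes> u = u'" unfolding w_def using car *(5)
      by (metis inv_closed inv_solve_left m_assoc m_closed)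
    then have w2: "w = u' \<otimes> inv u" unfolding w_def using car
      by (metis inv_closed inv_solve_right m_closed)
    have "w \<in> H" unfolding w_def using * H by (meson subgroup.m_closed subgroup.m_inv_closed)
    moreover have "w \<in> S" unfolding w2 using * S by (meson subgroup.m_closed subgroup.m_inv_closed)
    ultimately have "w = \<one>"
      using eq_one_if_coprime_pows[OF _ pow_card_subgroup[OF H] pow_card_subgroup[OF S] coprime_cards]
        H_carrier by blast
    then have "h = h'" unfolding w_def using car by (metis inv_closed inv_equality inv_inv)
    then show "h = h' \<and> u = u'" using *(5) car by simp
  qed
  moreover have "(\<lambda>(h, u). h \<otimes> u) ` (H \<times> S) = carrier G"
  proof (rule card_subset_eq[OF finite_carrier])
    show "(\<lambda>(h, u). h \<otimes> u) ` (H \<times> S) \<subseteq> carrier G" using H_carrier S_carrier by auto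
    show "card ((\<lambda>(h, u). h \<otimes> u) ` (H \<times> S)) = card (carrier G)"
      using order_eq by (simp add: card_image[OF inj] card_cartesian_product order_def)
  qed
  ultimately show ?thesis by (simp add: bij_betw_def)
qed

lemma sum_carrier: "sum f (carrier G) = (\<Sum>h\<in>H. \<Sum>u\<in>S. f (h \<otimes> u))"
  unfolding sum.cartesian_product using sum.reindex_bij_betw[OF bij_betw_mult, of f]
  by (simp add: case_prod_unfold)

text \<open>If \<open>card S\<close> kills \<open>w\<close>, it kills the \<open>H\<close>-component
  of \<open>w\<close>, whose order also divides the coprime number \<open>card H\<close>.\<close>

lemma mem_S_iff:
  assumes "w \<in> carrier G"
  shows "w \<in> S \<longleftrightarrow> w [^] card S = \<one>"
proof
  assume w: "w [^] card S = \<one>"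
  have "w \<in> (\<lambda>(h, u). h \<otimes> u) ` (H \<times> S)"
    using bij_betw_imp_surj_on[OF bij_betw_mult] assms by simp
  then obtain h u where hu: "h \<in> H" "u \<in> S" "w = h \<otimes> u" by auto
  have car: "h \<in> carrier G" "u \<in> carrier G" using hu H_carrier S_carrier by auto
  have "h [^] card S = \<one>"
    using w hu car pow_card_subgroup[OF S hu(2)] by (simp add: nat_pow_distrib)
  then have "h = \<one>"
    using eq_one_if_coprime_pows[OF car(1) pow_card_subgroup[OF H hu(1)] _ coprime_cards] by blast
  then show "w \<in> S" using hu car by simp
qed (rule pow_card_subgroup[OF S])

end

section \<open>Intersections of the difference set with the cosets of \<open>S\<close>\<close>

locale pds_hall = regular_pds G D m b c + hall_decomposition G H S
  for G (structure) and D m b c H S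
begin

text \<open>The part of \<open>D\<close> in the coset \<open>h S\<close>, translated back into
  \<open>S\<close>; its size is the number \<open>a h\<close> of the opening comment.\<close>

definition slice :: "'a \<Rightarrow> 'a set" where
  "slice h = {u \<in> S. h \<otimes> u \<in> D}"

lemma finite_slice: "finite (slice h)"
  using finite_S by (simp add: slice_def)

lemma card_slice: "int (card (slice h)) = (\<Sum>u\<in>S. of_bool (h \<otimes> u \<in> D))"
  using finite_S by (simp add: slice_def Int_def)

lemma sum_card_slice: "(\<Sum>h\<in>H. int (card (slice h))) = int (card D)"
proof -
  have "int (card D) = (\<Sum>x\<in>carrier G. of_bool (x \<in> D))"
    using finite_carrier D_subset by (simp add: Int_absorb1)
  then show ?thesis by (simp add: card_slice sum_carrier)
qed

text \<open>The substitution \<open>d = inv x\<close>, which preserves \<open>D\<close>, turns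
  \<open>card_differences\<close> into a count of \<open>x\<close> with both \<open>x\<close> and
  \<open>w \<otimes> x\<close> in \<open>D\<close>.\<close>

lemma card_translates:
  assumes "w \<in> carrier G"
  shows "(\<Sum>x\<in>carrier G. of_bool (x \<in> D) * of_bool (w \<otimes> x \<in> D))
    = (c\<^sup>2 - b\<^sup>2) * of_bool (w = \<one>) + 2 * b * of_bool (w \<in> D) + m"
proof -
  have "(\<Sum>x\<in>carrier G. of_bool (x \<in> D) * of_bool (w \<otimes> x \<in> D))
      = (\<Sum>x\<in>carrier G. of_bool (x \<in> D \<and> w \<otimes> x \<in> D) :: int)"
    by (simp add: of_bool_conj)
  also have "\<dots> = int (card {x \<in> D. w \<otimes> x \<in> D})"
    using finite_carrier D_subset by (auto simp: Int_def intro!: arg_cong[where f = card])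
  also have "card {x \<in> D. w \<otimes> x \<in> D} = card {d \<in> D. w \<otimes> inv d \<in> D}"
  proof (rule bij_betw_same_card[of "\<lambda>x. inv x"], rule bij_betw_byWitness[where f' = "\<lambda>x. inv x"])
  qed (use D_subset inv_D in auto)
  finally show ?thesis using card_differences[OF assms] by simp
qed

text \<open>The left side counts ordered pairs of elements of \<open>D\<close> in a common coset of
  \<open>S\<close>. Sorting them by their quotient \<open>w\<close> in \<open>S\<close> reduces this
  to \<open>card_translates\<close>.\<close>

lemma sum_card_slice_squared:
  "(\<Sum>h\<in>H. (int (card (slice h)))\<^sup>2)
    = c\<^sup>2 - b\<^sup>2 + 2 * b * int (card (slice \<one>)) + m * int (card S)"
proof -
  have "(int (card (slice h)))\<^sup>2
      = (\<Sum>w\<in>S. \<Sum>u\<in>S. of_bool (h \<otimes> u \<in> D) * of_bool (w \<otimes> (h \<otimes> u) \<in> D))"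
    if h: "h \<in> H" for h
  proof -
    have "(int (card (slice h)))\<^sup>2
        = (\<Sum>u\<in>S. \<Sum>w\<in>S. of_bool (h \<otimes> u \<in> D) * of_bool (h \<otimes> w \<in> D))"
      by (simp add: power2_eq_square card_slice sum_product)
    also have "\<dots> = (\<Sum>u\<in>S. \<Sum>w\<in>S. of_bool (h \<otimes> u \<in> D) * of_bool (w \<otimes> (h \<otimes> u) \<in> D))"
    proof (rule sum.cong[OF refl])
      fix u assume u: "u \<in> S"
      have car: "u \<in> carrier G" "h \<in> carrier G" using u h S_carrier H_carrier by auto
      \<comment> \<open>Replace the second element \<open>h \<otimes> w\<close> of the pair by
        \<open>w \<otimes> (h \<otimes> u)\<close>, so that \<open>w\<close> becomes the
        quotient.\<close>
      have "bij_betw (\<lambda>w. w \<otimes> u) S S"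
        by (rule bij_betw_byWitness[where f' = "\<lambda>w. w \<otimes> inv u"])
          (use u S S_carrier car in \<open>auto simp: m_assoc subgroup.m_closed subgroup.m_inv_closed\<close>)
      then have "(\<Sum>w\<in>S. of_bool (h \<otimes> u \<in> D) * of_bool (h \<otimes> w \<in> D))
          = (\<Sum>w\<in>S. of_bool (h \<otimes> u \<in> D) * (of_bool (h \<otimes> (w \<otimes> u) \<in> D) :: int))"
        by (rule sum.reindex_bij_betw[symmetric])
      also have "\<dots> = (\<Sum>w\<in>S. of_bool (h \<otimes> u \<in> D) * of_bool (w \<otimes> (h \<otimes> u) \<in> D))"
        using car S_carrier by (intro sum.cong) (auto simp: m_lcomm)
      finally show "(\<Sum>w\<in>S. of_bool (h \<otimes> u \<in> D) * of_bool (h \<otimes> w \<in> D))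
          = (\<Sum>w\<in>S. of_bool (h \<otimes> u \<in> D) * (of_bool (w \<otimes> (h \<otimes> u) \<in> D) :: int))" .
    qed
    also have "\<dots> = (\<Sum>w\<in>S. \<Sum>u\<in>S. of_bool (h \<otimes> u \<in> D) * of_bool (w \<otimes> (h \<otimes> u) \<in> D))"
      by (rule sum.swap)
    finally show ?thesis .
  qed
  then have "(\<Sum>h\<in>H. (int (card (slice h)))\<^sup>2)
      = (\<Sum>h\<in>H. \<Sum>w\<in>S. \<Sum>u\<in>S. of_bool (h \<otimes> u \<in> D) * of_bool (w \<otimes> (h \<otimes> u) \<in> D))"
    by (intro sum.cong) auto
  also have "\<dots> = (\<Sum>w\<in>S. \<Sum>x\<in>carrier G. of_bool (x \<in> D) * of_bool (w \<otimes> x \<in> D))"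
    unfolding sum_carrier by (rule sum.swap)
  also have "\<dots> = (\<Sum>w\<in>S. (c\<^sup>2 - b\<^sup>2) * of_bool (w = \<one>) + 2 * b * of_bool (\<one> \<otimes> w \<in> D) + m)"
    by (rule sum.cong) (auto simp: card_translates S_carrier)
  also have "\<dots> = (c\<^sup>2 - b\<^sup>2) * (\<Sum>w\<in>S. of_bool (w = \<one>)) + 2 * b * int (card (slice \<one>)) + m * int (card S)"
    by (simp only: sum.distrib sum_distrib_left[symmetric] card_slice) simp
  also have "(\<Sum>w\<in>S. of_bool (w = \<one>)) = (1 :: int)"
    using finite_S subgroup.one_closed[OF S] by (simp add: of_bool_def)
  finally show ?thesis by simp
qed

text \<open>Raising to the power \<open>p ^ n\<close> kills \<open>S\<close> and is injective on
  \<open>H\<close>, so \<open>D\<close> meets \<open>h S\<close> exactly in the elements with the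
  same \<open>p ^ n\<close>-th power as \<open>h\<close>.\<close>

lemma card_slice_cong_prime:
  assumes p: "Factorial_Ring.prime p" "int p dvd c" and "n > 0" "card S = p ^ n" and h: "h \<in> H"
  shows "[int (card (slice h)) = b * of_bool (h = \<one>)] (mod int p)"
proof -
  have hc: "h \<in> carrier G" using h H_carrier by blast
  have "card S > 1" using assms by (metis one_less_power prime_gt_1_nat)
  then have "\<not> S \<subseteq> {\<one>}" using card_mono[of "{\<one>}" S] by auto
  then obtain z where z: "z \<in> S" "z \<noteq> \<one>" by blast
  \<comment> \<open>Every \<open>p ^ n\<close>-th power is killed by \<open>card H\<close>, but
    \<open>z\<close> is not, so \<open>z\<close> serves as the element without roots.\<close>
  have nz: "x [^] (p ^ n) \<noteq> z" if x: "x \<in> carrier G" for x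
  proof
    assume "x [^] (p ^ n) = z"
    then have "z [^] card H = x [^] order G" using x assms(4)
      by (auto simp: nat_pow_pow order_eq mult.commute)
    then have "z [^] card H = \<one>" using pow_order_eq_1[OF x] by simp
    then show False using eq_one_if_coprime_pows[OF S_carrier[OF z(1)] _ pow_card_subgroup[OF S z(1)] coprime_cards] z(2)
      by blast
  qed
  have 1: "h [^] (p ^ n) = \<one> \<longleftrightarrow> h = \<one>"
    using eq_one_if_coprime_pows[OF hc pow_card_subgroup[OF H h] _ coprime_cards] assms(4) by auto
  have "card (slice h) = card {d \<in> D. d [^] (p ^ n) = h [^] (p ^ n)}"
  proof (rule bij_betw_same_card[of "\<lambda>u. h \<otimes> u"], rule bij_betw_byWitness[where f' = "\<lambda>d. inv h \<otimes> d"])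
    show "\<forall>u\<in>slice h. inv h \<otimes> (h \<otimes> u) = u"
      using hc S_carrier by (auto simp: slice_def m_assoc[symmetric])
    show "\<forall>d\<in>{d \<in> D. d [^] (p ^ n) = h [^] (p ^ n)}. h \<otimes> (inv h \<otimes> d) = d"
      using hc D_subset by (auto simp: m_assoc[symmetric])
    show "(\<otimes>) h ` slice h \<subseteq> {d \<in> D. d [^] (p ^ n) = h [^] (p ^ n)}"
      using hc S_carrier pow_card_subgroup[OF S] assms(4)
      by (auto simp: slice_def nat_pow_distrib)
    show "(\<otimes>) (inv h) ` {d \<in> D. d [^] (p ^ n) = h [^] (p ^ n)} \<subseteq> slice h"
    proof
      fix u assume "u \<in> (\<otimes>) (inv h) ` {d \<in> D. d [^] (p ^ n) = h [^] (p ^ n)}"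
      then obtain d where d: "d \<in> D" "d [^] (p ^ n) = h [^] (p ^ n)" "u = inv h \<otimes> d" by blast
      have dc: "d \<in> carrier G" using d D_subset by blast
      have "u [^] card S = \<one>"
        using d hc dc assms(4) by (simp add: nat_pow_distrib nat_pow_inv)
      then have "u \<in> S" using mem_S_iff d hc dc by simp
      moreover have "h \<otimes> u = d" using d hc dc by (simp add: m_assoc[symmetric])
      ultimately show "u \<in> slice h" using d by (simp add: slice_def)
    qed
  qed
  then show ?thesis
    using card_prime_power_roots[OF p \<open>n > 0\<close> S_carrier[OF z(1)] nz, of "h [^] (p ^ n)"] hc 1 by simp
qed

text \<open>Some power map \<open>u \<mapsto> u [^] s\<close> preserves the slice while fixing
  \<open>h\<close>. Away from \<open>\<one>\<close> its cycle lengths are multiples of the order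
  \<open>p - 1\<close> of \<open>s\<close> modulo \<open>p\<close>; \<open>\<one>\<close> is in the
  slice iff \<open>h \<in> D\<close>.\<close>

lemma card_slice_cong_totient:
  assumes p: "Factorial_Ring.prime p" and "card S = p ^ n" and h: "h \<in> H"
    and n: "n > 0" and c: "\<And>q. Factorial_Ring.prime q \<Longrightarrow> int q dvd 2 * c \<Longrightarrow> q dvd order G"
  shows "[card (slice h) = of_bool (h \<in> D)] (mod (p - 1))"
proof -
  have hc: "h \<in> carrier G" using h H_carrier by blast
  have pH: "coprime (card H) p" using coprime_cards assms(2) n by simp
  obtain g where g: "residue_primroot p g"
    using prime_primitive_root_exists[of p] prime_gt_1_nat[OF p] p by blast
  \<comment> \<open>The first congruence gives \<open>h [^] s = h\<close>, the second makes
    \<open>s\<close> a primitive root modulo \<open>p\<close>.\<close>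
  obtain s where s: "[s = 1] (mod card H)" "[s = g] (mod p)"
    using binary_chinese_remainder_nat[OF pH] by blast
  have s_prim: "residue_primroot p s" using residue_primroot_cong[OF s(2)] g by simp
  have "coprime s (card H)" using s(1) by (metis coprime_1_left cong_imp_coprime cong_sym)
  moreover have "coprime s (card S)" using s_prim assms(2)
    by (simp add: residue_primroot_def coprime_commute)
  ultimately have cop: "coprime s (order G)" by (simp add: order_eq)
  have hs: "h [^] s = h"
  proof -
    have "[s = 1] (mod ord h)"
      using s(1) pow_card_subgroup[OF H h] hc pow_eq_id cong_dvd_modulus_nat by blast
    then have "h [^] s = h [^] (1::nat)" using hc by (simp only: pow_eq_pow_iff_cong)
    then show ?thesis using hc by simp
  qed
  define T where "T = slice h - {\<one>}"
  have iter: "((\<lambda>u. u [^] s) ^^ i) u = u [^] (s ^ i)" if "u \<in> carrier G" for u i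
    using that by (induction i) (auto simp: nat_pow_pow mult.commute)
  have "p - 1 dvd card T"
  proof (rule dvd_card_if_dvd_periods[where f = "\<lambda>u. u [^] s"])
    show "finite T" using finite_slice by (simp add: T_def)
    show "u [^] s \<in> T" if u: "u \<in> T" for u
    proof -
      have uS: "u \<in> S" "u \<in> carrier G" "h \<otimes> u \<in> D" "u \<noteq> \<one>" using u S_carrier by (auto simp: T_def slice_def)
      have "(h \<otimes> u) [^] s \<in> D" using pow_coprime_mem[OF cop c uS(3)] by blast
      then have "h \<otimes> u [^] s \<in> D" using hc uS hs by (simp add: nat_pow_distrib)
      moreover have "u [^] s \<in> S" using mem_S_iff uS pow_card_subgroup[OF S uS(1)]
        by (metis nat_pow_closed nat_pow_one nat_pow_pow mult.commute)
      moreover have "u [^] s \<noteq> \<one>"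
        using eq_one_if_coprime_pows[OF uS(2) _ pow_order_eq_1[OF uS(2)] cop] uS(4) by blast
      ultimately show ?thesis by (simp add: T_def slice_def)
    qed
    show "\<exists>i>0. ((\<lambda>u. u [^] s) ^^ i) u = u" if u: "u \<in> T" for u
    proof -
      have uc: "u \<in> carrier G" using u S_carrier by (auto simp: T_def slice_def)
      have "[s ^ totient (order G) = 1] (mod order G)" using cop by (rule euler_theorem)
      then have "[s ^ totient (order G) = 1] (mod ord u)"
        using ord_dvd_group_order[OF uc] cong_dvd_modulus_nat by blast
      then have "u [^] (s ^ totient (order G)) = u [^] (1::nat)" using uc by (simp only: pow_eq_pow_iff_cong)
      moreover have "totient (order G) > 0" using finite_carrier order_gt_0_iff_finite by simp
      ultimately show ?thesis using uc
        by (intro exI[of _ "totient (order G)"]) (simp add: iter)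
    qed
    \<comment> \<open>A period \<open>i\<close> of \<open>u\<close> gives \<open>s ^ i = 1\<close>
      modulo \<open>ord u\<close>, hence modulo \<open>p\<close>, as
      \<open>u \<noteq> \<one>\<close> has \<open>p\<close>-power order.\<close>
    show "p - 1 dvd i" if u: "u \<in> T" "0 < i" "((\<lambda>u. u [^] s) ^^ i) u = u" for u i
    proof -
      have uS: "u \<in> S" "u \<in> carrier G" "u \<noteq> \<one>" using u S_carrier by (auto simp: T_def slice_def)
      have "u [^] (s ^ i) = u [^] (1::nat)" using u(3) uS by (simp add: iter)
      then have "[s ^ i = 1] (mod ord u)" using uS(2) by (simp only: pow_eq_pow_iff_cong)
      moreover have "p dvd ord u"
      proof -
        have "ord u dvd p ^ n" using pow_card_subgroup[OF S uS(1)] uS(2) pow_eq_id assms(2) by metis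
        then obtain j where "ord u = p ^ j" using p divides_primepow_nat by blast
        moreover have "ord u \<noteq> 1" using uS ord_eq_1 by blast
        ultimately show ?thesis by (cases j) auto
      qed
      ultimately have "[s ^ i = 1] (mod p)" using cong_dvd_modulus_nat by blast
      then have "Pocklington.ord p s dvd i" by (simp only: ord_divides)
      then show ?thesis using s_prim p by (simp add: residue_primroot_def totient_prime)
    qed
  qed
  moreover have "card (slice h) = card T + of_bool (h \<in> D)"
  proof -
    have "\<one> \<in> slice h \<longleftrightarrow> h \<in> D" using hc subgroup.one_closed[OF S] by (simp add: slice_def)
    then show ?thesis using finite_slice[of h] card_Suc_Diff1[of "slice h" \<one>]
      by (cases "h \<in> D") (auto simp: T_def)
  qed
  ultimately show ?thesis by (simp add: cong_def mod_add_left_eq[symmetric, of "card T"])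
qed

end


section \<open>Regular partial difference sets in groups of order \<open>8 p^3\<close>\<close>

lemma regular_pdsI:
  fixes G :: "('a, 'b) monoid_scheme" and b c :: int
  assumes "regular_PDS G D v k l m"
    and l: "int l = int m + 2 * b" and k: "int k = c\<^sup>2 - b\<^sup>2 + int m"
  shows "regular_pds G D (int m) b c"
proof -
  have PDS: "partial_difference_set G D v k l m" and inv: "(\<lambda>g. inv\<^bsub>G\<^esub> g) ` D = D" and one: "\<one>\<^bsub>G\<^esub> \<notin> D"
    using assms(1) by (auto simp: regular_PDS_def)
  interpret comm_group G using PDS by (simp add: partial_difference_set_def)
  have D: "finite (carrier G)" "D \<subseteq> carrier G" "card D = k"
    using PDS by (auto simp: partial_difference_set_def)
  have inv_D: "inv\<^bsub>G\<^esub> d \<in> D" if "d \<in> D" for d using inv that by blast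
  show ?thesis
  proof
    fix g assume g: "g \<in> carrier G"
    let ?P = "{(x, y). x \<in> D \<and> y \<in> D \<and> x \<noteq> y \<and> x \<otimes>\<^bsub>G\<^esub> inv\<^bsub>G\<^esub> y = g}"
    show "int (card {d \<in> D. g \<otimes>\<^bsub>G\<^esub> inv\<^bsub>G\<^esub> d \<in> D})
      = (c\<^sup>2 - b\<^sup>2) * of_bool (g = \<one>\<^bsub>G\<^esub>) + 2 * b * of_bool (g \<in> D) + int m"
    proof (cases "g = \<one>\<^bsub>G\<^esub>")
      case True
      have "{d \<in> D. \<one>\<^bsub>G\<^esub> \<otimes>\<^bsub>G\<^esub> inv\<^bsub>G\<^esub> d \<in> D} = D" using inv_D D by auto
      then show ?thesis using True one D k by simp
    next
      case False
      \<comment> \<open>A pair with quotient \<open>g\<close> is determined by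
        \<open>d = inv y\<close>; its entries differ because \<open>g\<close> is not the
        identity.\<close>
      have "card {d \<in> D. g \<otimes>\<^bsub>G\<^esub> inv\<^bsub>G\<^esub> d \<in> D} = card ?P"
      proof (rule bij_betw_same_card[of "\<lambda>d. (g \<otimes>\<^bsub>G\<^esub> inv\<^bsub>G\<^esub> d, inv\<^bsub>G\<^esub> d)"],
          rule bij_betw_byWitness[where f' = "\<lambda>(x, y). inv\<^bsub>G\<^esub> y"])
        show "\<forall>d\<in>{d \<in> D. g \<otimes>\<^bsub>G\<^esub> inv\<^bsub>G\<^esub> d \<in> D}.
            (case (g \<otimes>\<^bsub>G\<^esub> inv\<^bsub>G\<^esub> d, inv\<^bsub>G\<^esub> d) of (x, y) \<Rightarrow> inv\<^bsub>G\<^esub> y) = d"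
          using D by auto
        show "\<forall>a\<in>?P. (g \<otimes>\<^bsub>G\<^esub> inv\<^bsub>G\<^esub> (case a of (x, y) \<Rightarrow> inv\<^bsub>G\<^esub> y),
            inv\<^bsub>G\<^esub> (case a of (x, y) \<Rightarrow> inv\<^bsub>G\<^esub> y)) = a"
          using D by (auto simp: m_assoc subset_iff)
        show "(\<lambda>d. (g \<otimes>\<^bsub>G\<^esub> inv\<^bsub>G\<^esub> d, inv\<^bsub>G\<^esub> d)) ` {d \<in> D. g \<otimes>\<^bsub>G\<^esub> inv\<^bsub>G\<^esub> d \<in> D} \<subseteq> ?P"
        proof (clarify, intro conjI)
          fix d assume d: "d \<in> D" "g \<otimes>\<^bsub>G\<^esub> inv\<^bsub>G\<^esub> d \<in> D"
          then have dc: "d \<in> carrier G" using D by blast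
          show "inv\<^bsub>G\<^esub> d \<in> D" using inv_D d by blast
          show "g \<otimes>\<^bsub>G\<^esub> inv\<^bsub>G\<^esub> d \<noteq> inv\<^bsub>G\<^esub> d"
            using False dc g by (simp add: r_cancel_one)
          show "g \<otimes>\<^bsub>G\<^esub> inv\<^bsub>G\<^esub> d \<otimes>\<^bsub>G\<^esub> inv\<^bsub>G\<^esub> (inv\<^bsub>G\<^esub> d) = g"
            using dc g by (simp add: m_assoc)
        qed
        show "(\<lambda>(x, y). inv\<^bsub>G\<^esub> y) ` ?P \<subseteq> {d \<in> D. g \<otimes>\<^bsub>G\<^esub> inv\<^bsub>G\<^esub> d \<in> D}"
          using D inv_D by (auto simp: m_assoc subset_iff)
      qed
      moreover have "card ?P = (if g \<in> D then l else m)"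
        using PDS g False by (simp add: partial_difference_set_def)
      ultimately show ?thesis using False l by simp
    qed
  qed (use D inv_D one in auto)
qed

lemma no_regular_pds_8p3:
  fixes b :: int and p :: nat
  assumes p: "Factorial_Ring.prime p" "5 \<le> p" and b: "b\<^sup>2 + b + 2 = 4 * int p"
    and "order G = 8 * p ^ 3" "regular_pds G D (2 * int p - 2) b (2 * int p)"
  shows False
proof -
  interpret regular_pds G D "2 * int p - 2" b "2 * int p" by fact
  have "odd p" using p prime_odd_nat by auto
  obtain S where sylow_p: "subgroup S G" "card S = p ^ 3"
    using sylow_thm[of p G 3 8] p assms(4) finite_carrier is_group by (auto simp: mult.commute)
  obtain H where sylow_2: "subgroup H G" "card H = 8"
    using sylow_thm[of 2 G 3 "p ^ 3"] assms(4) finite_carrier is_group by auto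
  have "coprime 8 (p ^ 3)"
    using \<open>odd p\<close> coprime_power_left_iff[of 2 3 "p ^ 3"] by simp
  then interpret pds_hall G D "2 * int p - 2" b "2 * int p" H S
    using sylow_2 sylow_p assms(4) finite_carrier comm_group_axioms regular_pds_axioms
    by (simp add: pds_hall_def hall_decomposition_def hall_decomposition_axioms_def)
  \<comment> \<open>As \<open>p\<close> is odd, \<open>t = (p - 1) / 2\<close>, so
    \<open>t * int p\<close> below is \<open>p (p - 1) / 2\<close>.\<close>
  define t where "t = int p div 2"
  have t: "int p = 2 * t + 1" using \<open>odd p\<close> by (auto simp: t_def)
  define y where "y h = int (card (slice h)) - b * of_bool (h = \<one>\<^bsub>G\<^esub>) - t * int p" for h
  have y_dvd: "int p dvd y h" if "h \<in> H" for h
  proof -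
    have "int p dvd int (card (slice h)) - b * of_bool (h = \<one>\<^bsub>G\<^esub>)"
      using card_slice_cong_prime[OF p(1) _ _ sylow_p(2) that] by (simp add: cong_iff_dvd_diff)
    then show ?thesis unfolding y_def by (rule dvd_diff) simp
  qed
  have oneH: "\<one>\<^bsub>G\<^esub> \<in> H" using sylow_2(1) by (rule subgroup.one_closed)
  \<comment> \<open>The terms involving \<open>b\<close> occur only at the identity and are
    collected in the conditional.\<close>
  have "(\<Sum>h\<in>H. (y h)\<^sup>2) = (\<Sum>h\<in>H. (int (card (slice h)))\<^sup>2 - 2 * t * int p * int (card (slice h)) + (t * int p)\<^sup>2
      + (if h = \<one>\<^bsub>G\<^esub> then b\<^sup>2 - 2 * b * int (card (slice \<one>\<^bsub>G\<^esub>)) + 2 * b * t * int p else 0))"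
    by (rule sum.cong) (auto simp: y_def power2_eq_square algebra_simps)
  also have "\<dots> = (\<Sum>h\<in>H. (int (card (slice h)))\<^sup>2) - 2 * t * int p * (\<Sum>h\<in>H. int (card (slice h)))
      + 8 * (t * int p)\<^sup>2 + (b\<^sup>2 - 2 * b * int (card (slice \<one>\<^bsub>G\<^esub>)) + 2 * b * t * int p)"
    using oneH finite_H sylow_2(2) by (simp add: sum.distrib sum_subtractf sum_distrib_left)
  also have "\<dots> = 4 * (int p)\<^sup>2 - b\<^sup>2 + (2 * int p - 2) * int p ^ 3
      - 2 * t * int p * (4 * (int p)\<^sup>2 - b\<^sup>2 + (2 * int p - 2)) + 8 * (t * int p)\<^sup>2 + b\<^sup>2 + 2 * b * t * int p"
    unfolding sum_card_slice_squared sum_card_slice card_D by (simp add: sylow_p(2) power_mult_distrib)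
  \<comment> \<open>The excess over \<open>4 p^2\<close> is
    \<open>p (p - 1) (b^2 + b + 2 - 4 p)\<close>, which vanishes.\<close>
  also have "\<dots> = 4 * (int p)\<^sup>2"
  proof -
    have b2: "b\<^sup>2 = 4 * int p - b - 2" using b by simp
    show ?thesis unfolding b2 t by (simp add: algebra_simps power2_eq_square power3_eq_cube)
  qed
  finally have sum_y: "(\<Sum>h\<in>H. (y h)\<^sup>2) = 4 * (int p)\<^sup>2" .
  \<comment> \<open>Seven nonzero multiples of \<open>p\<close> would have squares summing to at
    least \<open>7 p^2\<close>.\<close>
  have "\<exists>h \<in> H - {\<one>\<^bsub>G\<^esub>}. y h = 0"
  proof (rule ccontr)
    assume "\<not> ?thesis"
    then have nz: "y h \<noteq> 0" if "h \<in> H - {\<one>\<^bsub>G\<^esub>}" for h using that by blast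
    have "7 * (int p)\<^sup>2 = (\<Sum>h\<in>H - {\<one>\<^bsub>G\<^esub>}. (int p)\<^sup>2)" using oneH sylow_2(2) finite_H by simp
    also have "\<dots> \<le> (\<Sum>h\<in>H - {\<one>\<^bsub>G\<^esub>}. (y h)\<^sup>2)"
    proof (rule sum_mono)
      fix h assume h: "h \<in> H - {\<one>\<^bsub>G\<^esub>}"
      then have "\<bar>int p\<bar> \<le> \<bar>y h\<bar>" using y_dvd nz by (intro dvd_imp_le_int) auto
      then show "(int p)\<^sup>2 \<le> (y h)\<^sup>2" by (simp only: abs_le_square_iff)
    qed
    also have "\<dots> \<le> (\<Sum>h\<in>H. (y h)\<^sup>2)" using finite_H by (intro sum_mono2) auto
    finally have "7 * (int p)\<^sup>2 \<le> 4 * (int p)\<^sup>2" using sum_y by simp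
    moreover have "(int p)\<^sup>2 > 0" using p by simp
    ultimately show False by linarith
  qed
  then obtain h where h: "h \<in> H" "h \<noteq> \<one>\<^bsub>G\<^esub>" "y h = 0" by blast
  have divs: "q dvd order G" if q: "Factorial_Ring.prime q" "int q dvd 2 * (2 * int p)" for q :: nat
  proof -
    have "int q dvd int (4 * p)" using q(2) by simp
    then have "q dvd 4 * p" by (simp only: int_dvd_int_iff)
    moreover have "4 * p dvd order G" using assms(4) by (simp add: power3_eq_cube)
    ultimately show ?thesis by (rule dvd_trans)
  qed
  have "[card (slice h) = of_bool (h \<in> D)] (mod (p - 1))"
    using card_slice_cong_totient[OF p(1) sylow_p(2) h(1) _ divs] by simp
  then have "[int (card (slice h)) = int (of_bool (h \<in> D))] (mod int (p - 1))"
    by (simp only: cong_int_iff)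
  moreover have "int (card (slice h)) = t * int p" using h by (simp add: y_def)
  moreover have "int (p - 1) = 2 * t" using p t by (simp add: of_nat_diff)
  \<comment> \<open>Modulo \<open>p - 1 = 2 t\<close> the slice size \<open>t (2 t + 1)\<close> is
    \<open>t\<close>, so \<open>2 t\<close> would divide \<open>t\<close> or \<open>t - 1\<close>;
    for \<open>t \<ge> 2\<close> both lie strictly between \<open>0\<close> and
    \<open>2 t\<close>.\<close>
  ultimately have "2 * t dvd t * (2 * t + 1) - of_bool (h \<in> D)"
    by (simp add: cong_iff_dvd_diff t)
  then have "2 * t dvd t * (2 * t + 1) - of_bool (h \<in> D) - 2 * t * t"
    by (rule dvd_diff) simp
  then have "2 * t dvd t - of_bool (h \<in> D)" by (simp add: algebra_simps)
  moreover have "t \<ge> 2" using p t by linarith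
  ultimately show False using zdvd_imp_le[of "2 * t" "t - of_bool (h \<in> D)"]
    by (cases "h \<in> D") auto
qed

theorem theorem3:
  fixes G :: "('a, 'b) monoid_scheme"
    and y \<beta> :: int
    and p k l m :: nat
  assumes "int p = 4 * y ^ 2 + 3 * y + 1"
    and "Factorial_Ring.prime p"
    and "5 \<le> p"
    and "\<beta> \<in> {- 8 * y - 4, 8 * y + 2}"
    and "int m = 2 * int p - 2"
    and "int l = int m + \<beta>"
    and "real k = 4 * real p ^ 2 - 2 * real p + real_of_int \<beta> / 2"
    and "comm_group G"
    and "order G = 8 * p ^ 3"
  shows "\<not> (\<exists>D. regular_PDS G D (8 * p ^ 3) k l m \<and> \<not> trivial_PDS G D)"
proof
  assume "\<exists>D. regular_PDS G D (8 * p ^ 3) k l m \<and> \<not> trivial_PDS G D"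
  then obtain D where D: "regular_PDS G D (8 * p ^ 3) k l m" by blast
  obtain b where \<beta>: "\<beta> = 2 * b" and b: "b = - 4 * y - 2 \<or> b = 4 * y + 1"
  proof
    show "\<beta> = 2 * (\<beta> div 2)" "\<beta> div 2 = - 4 * y - 2 \<or> \<beta> div 2 = 4 * y + 1" using assms(4) by auto
  qed
  \<comment> \<open>The two candidates for \<open>b\<close> have sum \<open>-1\<close> and product
    \<open>2 - 4 p\<close>, so they are the roots of \<open>X^2 + X + 2 - 4 p\<close>.\<close>
  have b2: "b\<^sup>2 + b + 2 = 4 * int p"
    using b by (elim disjE; simp only: assms(1)) (simp_all add: power2_eq_square algebra_simps)
  have "real_of_int (int k) = real_of_int (4 * (int p)\<^sup>2 - 2 * int p + b)"
    using assms(7) \<beta> by simp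
  then have "int k = 4 * (int p)\<^sup>2 - 2 * int p + b" by (simp only: of_int_eq_iff)
  \<comment> \<open>This identifies \<open>c = 2 p\<close>: substitute
    \<open>b = 4 p - 2 - b^2\<close> and \<open>m = 2 p - 2\<close>.\<close>
  then have "int k = (2 * int p)\<^sup>2 - b\<^sup>2 + int m"
    using b2 assms(5) by (simp add: power_mult_distrib)
  moreover have "int l = int m + 2 * b" using assms(6) \<beta> by simp
  ultimately have "regular_pds G D (2 * int p - 2) b (2 * int p)"
    using regular_pdsI[OF D] assms(5) by metis
  then show False using no_regular_pds_8p3[OF assms(2,3) b2 assms(9)] by blast
qed

end
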